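(* In the setting described in the context (uniform-grid model with $\beta=1$, kernel $K$ satisfying the kernel assumption, estimator $\hat f=\hat\iota/\Delta t$), assume $\Delta t \asymp n^{-\frac{1}{4+d}}$. Then, for $x_0\in[0,1]^d$, $$\mathbf{E}\big[\|\hat f(x_0)-f^\star(x_0)\|_2^2\big] \preccurlyeq n^{-\frac{2}{4+d}} .$$
   Context: Asymptotic notation (as $n\to\infty$): $a_n\preccurlyeq b_n$ means $\limsup_{n\to\infty} a_n/b_n<\infty$; $a_n\asymp b_n$ means $a_n\preccurlyeq b_n$ and $b_n\preccurlyeq a_n$. The quantities $d$, $L_0,L_1$, $\sigma$, $K$ are fixed; all other quantities (in particular $\Delta t$) may vary with $n$. Flow and increment: for a Lipschitz $f\colon\mathbb R^d\to\mathbb R^d$, $U(f,x,\cdot)$ is the unique solution $u$ of $\dot u(t)=f(u(t))$, $u(0)=x$. The increment map is $\Upsilon(f,\Delta t,x):=U(f,x,\Delta t)-x$. Smoothness class: $\mathcal F$ is the set of continuously differentiable $f\colon\mathbb R^d\to\mathbb R^d$ with $\sup_x\|f(x)\|_2\le L_0$ and $\sup_x\|Df(x)\|_{\mathsf{op}}\le L_1$, where $L_0,L_1>0$. Model: $d\in\mathbb N$, $f^\star\in\mathcal F$, $n_0\in\mathbb N$, $n:=n_0^d$, and $\{x_1,\dots,x_n\}=\{(k_1/n_0,\dots,k_d/n_0)^\top : k_1,\dots,k_d\in\{1,\dots,n_0\}\}$. Let $\sigma\ge 0$, let $\varepsilon_1,\dots,\varepsilon_n$ be independent $\mathbb R^d$-valued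 random variables with $\mathbf E[\varepsilon_j]=0$, $\mathbf E[\|\varepsilon_j\|_2^2]\le\sigma^2$, let $\Delta t>0$, and observe $Y_j:=U(f^\star,x_j,\Delta t)+\varepsilon_j$, $j=1,\dots,n$. Kernel assumption: $K\colon[0,\infty)\to\mathbb R$ is Lipschitz continuous, nonnegative, not identically zero, and there is $C_{\mathsf{ker}}>0$ with $K(z)\le C_{\mathsf{ker}}\mathbf 1_{[0,1]}(z)$ for all $z\ge0$. Estimator: $\hat\iota$ is the local constant (Nadaraya--Watson) estimator of $\iota^\star:=\Upsilon(f^\star,\Delta t,\cdot)$ with kernel $K$ and bandwidth $h$, applied to each component: $\hat\iota(x)\in\arg\min_{\theta\in\mathbb R^d}\sum_{j=1}^n\|Y_j-x_j-\theta\|_2^2\,K(\|x_j-x\|_2/h)$, that is, $\hat\iota(x)=\sum_j (Y_j-x_j)K(\|x_j-x\|_2/h)/\sum_j K(\|x_j-x\|_2/h)$ when the denominator is positive. The bandwidth is of the optimal order, $h\asymp(\Delta t^2 n)^{-1/(2+d)}$ (the optimal order for estimating a Lipschitz function with Lipschitz constant of order $\Delta t$ on $[0,1]^d$ from $n$ observations). Finally $\hat f(x):=\hat\iota(x)/\Delta t$. *)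

theory Defs
  imports "HOL-Probability.Probability"
begin

text \<open>Asymptotic order of nonnegative sequences. The values are taken in \<^typ>\<open>ennreal\<close>, so that
  an infinite expectation counts as infinite instead of being totalized to \<open>0\<close>.\<close>

definition asymp_le :: "(nat \<Rightarrow> ennreal) \<Rightarrow> (nat \<Rightarrow> ennreal) \<Rightarrow> bool"  (infix "\<preceq>" 50)
  where "a \<preceq> b \<longleftrightarrow> limsup (\<lambda>k. a k / b k) < \<infinity>"

definition asymp_eq :: "(nat \<Rightarrow> ennreal) \<Rightarrow> (nat \<Rightarrow> ennreal) \<Rightarrow> bool"  (infix "\<asymp>" 50)
  where "a \<asymp> b \<longleftrightarrow> a \<preceq> b \<and> b \<preceq> a"

text \<open>For globally Lipschitz \<open>f\<close> the initial value problem has exactly one solution on the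
  whole real line, and \<open>flow f x\<close> denotes it; no other \<open>f\<close> is of interest.\<close>

definition flow :: "('a::real_normed_vector \<Rightarrow> 'a) \<Rightarrow> 'a \<Rightarrow> real \<Rightarrow> 'a"
  where "flow f x =
    (THE u. u 0 = x \<and> (\<forall>t. (u has_vector_derivative f (u t)) (at t)))"

text \<open>The norm of a bounded linear map of type \<^typ>\<open>'a \<Rightarrow>\<^sub>L 'a\<close> is its operator norm, and
  continuity of the derivative refers to that norm.\<close>

definition smooth_class :: "real \<Rightarrow> real \<Rightarrow> ('a::euclidean_space \<Rightarrow> 'a) set"
  where "smooth_class L0 L1 =
    {f. (\<forall>x. norm (f x) \<le> L0) \<and>
        (\<exists>Df :: 'a \<Rightarrow> 'a \<Rightarrow>\<^sub>L 'a.
           (\<forall>x. (f has_derivative blinfun_apply (Df x)) (at x)) \<and>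
           continuous_on UNIV Df \<and> (\<forall>x. norm (Df x) \<le> L1))}"

definition unif_grid :: "nat \<Rightarrow> (real ^ 'd) set"
  where "unif_grid n0 = {x. \<forall>i. \<exists>k\<in>{1..n0}. x $ i = real k / real n0}"

text \<open>Kernels are functions on \<open>[0,\<infinity>)\<close>; values at negative arguments are irrelevant.\<close>

definition nw_kernel :: "(real \<Rightarrow> real) \<Rightarrow> bool"
  where "nw_kernel K \<longleftrightarrow>
    (\<exists>L. L-lipschitz_on {0..} K) \<and>
    (\<forall>z\<ge>0. K z \<ge> 0) \<and>
    (\<exists>z\<ge>0. K z \<noteq> 0) \<and>
    (\<exists>C>0. \<forall>z\<ge>0. K z \<le> C * indicator {0..1} z)"

text \<open>The local constant (Nadaraya--Watson) fit \<open>\<theta>\<close> at the point \<open>y\<close>, for design points \<open>x j\<close> and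
  responses \<open>z j\<close>, \<open>1 \<le> j \<le> n\<close>. If all weights vanish, every \<open>\<theta>\<close> qualifies.\<close>

definition is_local_constant_fit ::
    "(real \<Rightarrow> real) \<Rightarrow> real \<Rightarrow> nat \<Rightarrow> (nat \<Rightarrow> 'a::real_normed_vector) \<Rightarrow> (nat \<Rightarrow> 'a) \<Rightarrow> 'a \<Rightarrow> 'a \<Rightarrow> bool"
  where "is_local_constant_fit K h n x z y \<theta> \<longleftrightarrow>
    is_arg_min (\<lambda>\<theta>. \<Sum>j=1..n. (norm (z j - \<theta>))\<^sup>2 * K (norm (x j - y) / h)) (\<lambda>_. True) \<theta>"

end

theory Submission
  imports Defs "HOL-Real_Asymp.Real_Asymp"
begin

text \<open>The estimate \<open>\<theta> / \<Delta>t\<close> is a weighted mean of the difference quotients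
  \<open>(Y j - x j) / \<Delta>t\<close> over design points within distance \<open>h\<close> of \<open>x0\<close>. Replacing such a quotient
  by \<open>f x0\<close> costs at most \<open>L1 * (L0 * \<Delta>t + h)\<close>, apart from the noise. The noise contributes at most
  \<open>\<sigma>\<^sup>2 / \<Delta>t\<^sup>2\<close> times the largest weight. The kernel is bounded away from 0 on some interval, so the
  sum of all kernel values is at least of order \<open>n * h ^ d\<close> and the largest weight at most of order
  \<open>1 / (n * h ^ d)\<close>. With \<open>q = n powr (- 1 / (4 + d))\<close>, both \<open>\<Delta>t\<close> and \<open>h\<close> are of order \<open>q\<close> and
  \<open>n * q ^ (d + 4) = 1\<close>, so squared bias and variance are both of order \<open>q\<^sup>2\<close>.\<close>

section \<open>Flows of bounded Lipschitz vector fields\<close>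

text \<open>Integrating the bound on \<open>G'\<close> from 0 to \<open>t \<ge> 0\<close> gives
  \<open>B / c * (exp (c * t) - 1)\<close>; negative times follow by reflecting \<open>G\<close>.
  The factor \<open>1 / c\<close> gained by integration is what makes the Picard map below a
  contraction.\<close>

lemma norm_le_exp_if_vector_derivative_le:
  fixes G :: "real \<Rightarrow> 'a::euclidean_space"
  assumes G: "\<And>t. (G has_vector_derivative G' t) (at t)" and "G 0 = 0" and "c > 0"
    and le: "\<And>t. norm (G' t) \<le> B * exp (c * \<bar>t\<bar>)"
  shows "norm (G t) \<le> B / c * exp (c * \<bar>t\<bar>)"
proof -
  have B: "B \<ge> 0"
    using order_trans[OF norm_ge_zero le[of 0]] by simp
  have pos: "norm (H t) \<le> B / c * exp (c * t)"
    if H: "\<And>t. (H has_vector_derivative H' t) (at t)" and "H 0 = 0" and "t \<ge> 0"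
      and le: "\<And>t. norm (H' t) \<le> B * exp (c * \<bar>t\<bar>)" for H :: "real \<Rightarrow> 'a" and H' t
  proof (cases "t = 0")
    case False
    have cont: "continuous_on S H" for S
      by (meson H continuous_at_imp_continuous_on has_vector_derivative_continuous)
    have "norm (H t - H 0) \<le> B / c * exp (c * t) - B / c * exp (c * 0)"
    proof (rule differentiable_bound_general[where f' = H' and \<phi>' = "\<lambda>t. B * exp (c * t)"])
      show "((\<lambda>t. B / c * exp (c * t)) has_vector_derivative B * exp (c * s)) (at s)" for s
        unfolding has_real_derivative_iff_has_vector_derivative[symmetric]
        using \<open>c > 0\<close> by (auto intro!: derivative_eq_intros)
      show "norm (H' s) \<le> B * exp (c * s)" if "0 < s" for s
        using le[of s] that by simp
    qed (use False \<open>t \<ge> 0\<close> \<open>c > 0\<close> H in \<open>auto intro!: cont continuous_intros\<close>)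
    then show ?thesis
      using B \<open>c > 0\<close> \<open>H 0 = 0\<close> by (simp add: field_simps)
  qed (use B \<open>c > 0\<close> \<open>H 0 = 0\<close> in auto)
  show ?thesis
  proof (cases "t \<ge> 0")
    case True
    then show ?thesis
      using pos[OF G \<open>G 0 = 0\<close> True le] by simp
  next
    case False
    have minus: "(uminus has_vector_derivative - 1) (at s)" for s :: real
      unfolding has_real_derivative_iff_has_vector_derivative[symmetric]
      by (auto intro!: derivative_eq_intros)
    have "((\<lambda>t. G (- t)) has_vector_derivative - G' (- s)) (at s)" for s
      using vector_diff_chain_at[OF minus G[of "- s"]] by (simp add: comp_def)
    from pos[OF this, of "- t"] show ?thesis
      using False \<open>G 0 = 0\<close> le[of "- _"] by simp
  qed
qed

text \<open>For continuous \<open>F\<close> this is the integral of \<open>F\<close> from 0 to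
  \<open>t\<close>. Choosing an antiderivative that vanishes at 0 treats both signs of
  \<open>t\<close> alike, without oriented integrals.\<close>

definition primitive :: "(real \<Rightarrow> 'a::euclidean_space) \<Rightarrow> real \<Rightarrow> 'a"
  where "primitive F = (SOME G. G 0 = 0 \<and> (\<forall>t. (G has_vector_derivative F t) (at t)))"

lemma primitive:
  fixes F :: "real \<Rightarrow> 'a::euclidean_space"
  assumes "continuous_on UNIV F"
  shows primitive_0: "primitive F 0 = 0"
    and has_vector_derivative_primitive: "(primitive F has_vector_derivative F t) (at t)"
proof -
  have "isCont F t" for t
    using assms by (simp add: continuous_on_eq_continuous_at)
  then obtain G where G: "\<And>t. (G has_vector_derivative F t) (at t)"
    using einterval_antiderivative[of "-\<infinity>" "\<infinity>" F] by auto
  have "((\<lambda>t. G t - G 0) has_vector_derivative F t) (at t)" for t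
    using G[of t] by (auto intro!: derivative_eq_intros)
  then have "\<exists>H. H 0 = 0 \<and> (\<forall>t. (H has_vector_derivative F t) (at t))"
    by (intro exI[of _ "\<lambda>t. G t - G 0"]) auto
  from someI_ex[OF this] show "primitive F 0 = 0" "(primitive F has_vector_derivative F t) (at t)"
    by (auto simp: primitive_def)
qed

text \<open>Picard iteration in the weighted norm \<open>SUP t. exp (- 2 * L * \<bar>t\<bar>) * norm (u t - x)\<close>: the
  weight makes the Picard map a contraction on the whole real line at once.\<close>

lemma flow_exists:
  fixes f :: "'a::euclidean_space \<Rightarrow> 'a"
  assumes bound: "\<And>x. norm (f x) \<le> L0" and "L > 0"
    and lip: "\<And>x y. norm (f x - f y) \<le> L * norm (x - y)"
  shows "\<exists>u. u 0 = x \<and> (\<forall>t. (u has_vector_derivative f (u t)) (at t))"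
proof -
  \<comment> \<open>With this exponent the contraction factor \<open>L / c\<close> is
    \<open>1/2\<close>.\<close>
  define c where "c = 2 * L"
  have c: "c > 0"
    using \<open>L > 0\<close> by (simp add: c_def)
  have L0: "L0 \<ge> 0"
    using bound[of 0] norm_ge_zero order_trans by blast
  have "L-lipschitz_on UNIV f"
    using lip \<open>L > 0\<close> by (auto simp: lipschitz_on_def dist_norm)
  then have contf: "continuous_on UNIV f"
    by (rule lipschitz_on_continuous_on)
  \<comment> \<open>The unknown \<open>g\<close> is the rescaled displacement
    \<open>exp (- c * \<bar>s\<bar>) *\<^sub>R (u s - x)\<close> of the solution \<open>u\<close>
    sought, so the sup norm of \<open>g\<close> is the weighted norm and \<open>F g s\<close> stands
    for \<open>f (u s)\<close>.\<close>
  define F where "F g s = f (x + exp (c * \<bar>s\<bar>) *\<^sub>R apply_bcontfun g s)"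
    for g :: "real \<Rightarrow>\<^sub>C 'a" and s
  have contF: "continuous_on UNIV (F g)" for g
    unfolding F_def
    by (rule continuous_on_compose2[OF contf]) (auto intro!: continuous_intros)
  define T where "T g = Bcontfun (\<lambda>t. exp (- c * \<bar>t\<bar>) *\<^sub>R primitive (F g) t)" for g
  \<comment> \<open>\<open>Bcontfun\<close> is meaningful only on bounded continuous functions.
    Boundedness holds because \<open>f\<close> is bounded by \<open>L0\<close>, so that the
    primitive grows no faster than \<open>exp (c * \<bar>t\<bar>)\<close>.\<close>
  have "(\<lambda>t. exp (- c * \<bar>t\<bar>) *\<^sub>R primitive (F g) t) \<in> bcontfun" for g
  proof (rule bcontfun_normI)
    have "continuous_on UNIV (primitive (F g))"
      by (meson has_vector_derivative_primitive[OF contF] continuous_at_imp_continuous_on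
          has_vector_derivative_continuous)
    then show "continuous_on UNIV (\<lambda>t. exp (- c * \<bar>t\<bar>) *\<^sub>R primitive (F g) t)"
      by (auto intro!: continuous_intros)
    fix t
    have "norm (primitive (F g) t) \<le> L0 / c * exp (c * \<bar>t\<bar>)"
    proof (rule norm_le_exp_if_vector_derivative_le[OF has_vector_derivative_primitive[OF contF]])
      fix s
      have "norm (F g s) \<le> L0 * 1"
        using bound by (simp add: F_def)
      also have "\<dots> \<le> L0 * exp (c * \<bar>s\<bar>)"
        using L0 c by (intro mult_left_mono) auto
      finally show "norm (F g s) \<le> L0 * exp (c * \<bar>s\<bar>)" .
    qed (use c primitive_0[OF contF] in auto)
    then show "norm (exp (- c * \<bar>t\<bar>) *\<^sub>R primitive (F g) t) \<le> L0 / c"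
      by (simp add: exp_minus field_simps)
  qed
  then have T: "apply_bcontfun (T g) t = exp (- c * \<bar>t\<bar>) *\<^sub>R primitive (F g) t" for g t
    by (simp add: T_def Bcontfun_inverse)
  have "dist (T g1) (T g2) \<le> 1/2 * dist g1 g2" for g1 g2
  proof (rule dist_bound)
    fix t
    let ?G = "\<lambda>t. primitive (F g1) t - primitive (F g2) t"
    \<comment> \<open>By the Lipschitz condition the two integrands differ by at most
      \<open>L * dist g1 g2\<close> times the inverse weight; integration divides this by
      \<open>c\<close>.\<close>
    have "norm (?G t) \<le> L * dist g1 g2 / c * exp (c * \<bar>t\<bar>)"
    proof (rule norm_le_exp_if_vector_derivative_le)
      show "(?G has_vector_derivative F g1 s - F g2 s) (at s)" for s
        by (intro derivative_intros has_vector_derivative_primitive contF)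
      show "norm (F g1 s - F g2 s) \<le> L * dist g1 g2 * exp (c * \<bar>s\<bar>)" for s
      proof -
        have "norm (F g1 s - F g2 s)
            \<le> L * norm (exp (c * \<bar>s\<bar>) *\<^sub>R (apply_bcontfun g1 s - apply_bcontfun g2 s))"
          unfolding F_def by (rule order_trans[OF lip]) (simp add: scaleR_diff_right)
        also have "\<dots> = L * exp (c * \<bar>s\<bar>) * dist (apply_bcontfun g1 s) (apply_bcontfun g2 s)"
          by (simp add: dist_norm)
        also have "\<dots> \<le> L * exp (c * \<bar>s\<bar>) * dist g1 g2"
          using \<open>L > 0\<close> by (intro mult_left_mono dist_bounded) auto
        finally show ?thesis
          by (simp add: mult_ac)
      qed
    qed (use c primitive_0[OF contF] in auto)
    then have "exp (- c * \<bar>t\<bar>) * norm (?G t) \<le> 1/2 * dist g1 g2"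
      using \<open>L > 0\<close> by (simp add: c_def exp_minus field_simps)
    then show "dist (apply_bcontfun (T g1) t) (apply_bcontfun (T g2) t) \<le> 1/2 * dist g1 g2"
      by (simp add: T dist_norm scaleR_diff_right[symmetric])
  qed
  then have "\<exists>!g. T g = g"
    by (intro banach_fix_type[of "1/2"]) auto
  then obtain g where g: "T g = g"
    by blast
  \<comment> \<open>At the fixed point, undoing the rescaling turns \<open>F g t\<close> into
    \<open>f (?u t)\<close>, which is the differential equation.\<close>
  let ?u = "\<lambda>t. x + primitive (F g) t"
  have "?u t = x + exp (c * \<bar>t\<bar>) *\<^sub>R apply_bcontfun g t" for t
    using T[of g t] by (simp add: g exp_minus)
  then have "F g t = f (?u t)" for t
    by (simp add: F_def)
  then have "(?u has_vector_derivative f (?u t)) (at t)" for t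
    using has_vector_derivative_primitive[OF contF, of g t]
    by (auto intro!: derivative_eq_intros)
  then show ?thesis
    using primitive_0[OF contF] by (intro exI[of _ ?u]) auto
qed

text \<open>Gronwall's argument for the squared distance \<open>D\<close>: since
  \<open>\<bar>D'\<bar> \<le> 2 * L * D\<close>, the product \<open>D s * exp (- 2 * L * s)\<close>
  does not increase for \<open>s \<ge> 0\<close>, and \<open>D s * exp (2 * L * s)\<close> does not
  decrease for \<open>s \<le> 0\<close>. Both vanish at 0 and \<open>D\<close> is nonnegative, so
  \<open>D\<close> is zero everywhere.\<close>

lemma flow_unique:
  fixes f :: "'a::euclidean_space \<Rightarrow> 'a"
  assumes lip: "\<And>x y. norm (f x - f y) \<le> L * norm (x - y)"
    and u: "\<And>t. (u has_vector_derivative f (u t)) (at t)"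
    and v: "\<And>t. (v has_vector_derivative f (v t)) (at t)"
    and "u 0 = v 0"
  shows "u = v"
proof
  fix t
  define D where "D s = (norm (u s - v s))\<^sup>2" for s
  define D' where "D' s = 2 * ((u s - v s) \<bullet> (f (u s) - f (v s)))" for s
  have D: "(D has_real_derivative D' s) (at s)" for s
    unfolding D_def D'_def power2_norm_eq_inner has_real_derivative_iff_has_vector_derivative
    using u[of s] v[of s] unfolding has_vector_derivative_def
    by (auto intro!: derivative_eq_intros simp: algebra_simps inner_commute)
  have D': "\<bar>D' s\<bar> \<le> 2 * L * D s" for s
  proof -
    have "\<bar>(u s - v s) \<bullet> (f (u s) - f (v s))\<bar> \<le> norm (u s - v s) * norm (f (u s) - f (v s))"
      by (rule Cauchy_Schwarz_ineq2)
    also have "\<dots> \<le> norm (u s - v s) * (L * norm (u s - v s))"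
      by (intro mult_left_mono lip) auto
    finally show ?thesis
      by (simp add: D_def D'_def power2_eq_square algebra_simps)
  qed
  have "D t \<le> 0"
  proof (cases "t \<ge> 0")
    case True
    have "D t * exp (- 2 * L * t) \<le> D 0 * exp (- 2 * L * 0)"
    proof (rule DERIV_nonpos_imp_nonincreasing[OF True], intro exI conjI)
      show "((\<lambda>s. D s * exp (- 2 * L * s)) has_real_derivative
          (D' s - 2 * L * D s) * exp (- 2 * L * s)) (at s)" for s
        using D[of s] by (auto intro!: derivative_eq_intros simp: algebra_simps)
      show "(D' s - 2 * L * D s) * exp (- 2 * L * s) \<le> 0" for s
        using D'[of s] by (intro mult_nonpos_nonneg) auto
    qed
    then show ?thesis
      using \<open>u 0 = v 0\<close> by (simp add: D_def mult_le_0_iff)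
  next
    case False
    have "D t * exp (2 * L * t) \<le> D 0 * exp (2 * L * 0)"
    proof (rule DERIV_nonneg_imp_nondecreasing[of t 0], use False in simp, intro exI conjI)
      show "((\<lambda>s. D s * exp (2 * L * s)) has_real_derivative
          (D' s + 2 * L * D s) * exp (2 * L * s)) (at s)" for s
        using D[of s] by (auto intro!: derivative_eq_intros simp: algebra_simps)
      show "(D' s + 2 * L * D s) * exp (2 * L * s) \<ge> 0" for s
        using D'[of s] by (intro mult_nonneg_nonneg) auto
    qed
    then show ?thesis
      using \<open>u 0 = v 0\<close> by (simp add: D_def mult_le_0_iff)
  qed
  then show "u t = v t"
    by (simp add: D_def)
qed

section \<open>Flows of fields in the smoothness class\<close>

lemma smooth_class_lipschitz:
  fixes f :: "'a::euclidean_space \<Rightarrow> 'a"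
  assumes "f \<in> smooth_class L0 L1"
  shows "norm (f x - f y) \<le> L1 * norm (x - y)"
proof -
  obtain Df :: "'a \<Rightarrow> 'a \<Rightarrow>\<^sub>L 'a"
    where "\<And>x. (f has_derivative blinfun_apply (Df x)) (at x)" "\<And>x. norm (Df x) \<le> L1"
    using assms unfolding smooth_class_def by blast
  then show ?thesis
    by (intro differentiable_bound[of UNIV f "\<lambda>x. blinfun_apply (Df x)"])
      (auto simp: norm_blinfun.rep_eq)
qed

text \<open>Existence and uniqueness together justify the definite description in
  \<open>flow\<close>; from here on only these two properties of the flow are used.\<close>

lemma flow_smooth_class:
  fixes f :: "'a::euclidean_space \<Rightarrow> 'a"
  assumes f: "f \<in> smooth_class L0 L1" and "L1 > 0"
  shows flow_0: "flow f x 0 = x"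
    and has_vector_derivative_flow: "(flow f x has_vector_derivative f (flow f x t)) (at t)"
proof -
  have "norm (f y) \<le> L0" for y
    using f by (auto simp: smooth_class_def)
  then have "\<exists>u. u 0 = x \<and> (\<forall>t. (u has_vector_derivative f (u t)) (at t))"
    using smooth_class_lipschitz[OF f] \<open>L1 > 0\<close> by (intro flow_exists[of f L0 L1]) auto
  then have "\<exists>!u. u 0 = x \<and> (\<forall>t. (u has_vector_derivative f (u t)) (at t))"
    using flow_unique[OF smooth_class_lipschitz[OF f]] by metis
  from theI'[OF this] show "flow f x 0 = x" "(flow f x has_vector_derivative f (flow f x t)) (at t)"
    by (auto simp: flow_def)
qed

lemma norm_increment_le:
  fixes u :: "real \<Rightarrow> 'a::euclidean_space"
  assumes "\<And>t. (u has_vector_derivative u' t) (at t)"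
    and "\<And>s. 0 \<le> s \<Longrightarrow> s \<le> t \<Longrightarrow> norm (u' s) \<le> B" and "t \<ge> 0"
  shows "norm (u t - u 0) \<le> B * t"
proof -
  have "norm (u t - u 0) \<le> B * norm (t - 0)"
  proof (rule differentiable_bound[of "{0..t}" u "\<lambda>s h. h *\<^sub>R u' s"])
    show "(u has_derivative (\<lambda>h. h *\<^sub>R u' s)) (at s within {0..t})" for s
      using assms(1)[of s] has_derivative_at_withinI has_vector_derivative_def by blast
    show "onorm (\<lambda>h. h *\<^sub>R u' s) \<le> B" if "s \<in> {0..t}" for s
      using assms(2)[of s] that by (simp add: onorm_scaleR_left onorm_id)
  qed (use \<open>t \<ge> 0\<close> in auto)
  then show ?thesis
    using \<open>t \<ge> 0\<close> by simp
qed

text \<open>The curve \<open>flow f x s - s *\<^sub>R f x\<close> has derivative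
  \<open>f (flow f x s) - f x\<close>. Up to time \<open>t\<close> the flow has moved by at most
  \<open>L0 * t\<close>, so this derivative is at most \<open>L1 * (L0 * t)\<close>, and integration
  contributes another factor \<open>t\<close>.\<close>

lemma flow_increment_approx:
  fixes f :: "'a::euclidean_space \<Rightarrow> 'a"
  assumes f: "f \<in> smooth_class L0 L1" and "L1 > 0" and "t \<ge> 0"
  shows "norm (flow f x t - x - t *\<^sub>R f x) \<le> L0 * L1 * t\<^sup>2"
proof -
  note flow = flow_0[OF f \<open>L1 > 0\<close>] has_vector_derivative_flow[OF f \<open>L1 > 0\<close>]
  have bound: "norm (f y) \<le> L0" for y
    using f by (auto simp: smooth_class_def)
  then have L0: "L0 \<ge> 0"
    using norm_ge_zero order_trans by blast
  have *: "norm (flow f x s - x) \<le> L0 * s" if "s \<ge> 0" for s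
    using norm_increment_le[OF flow(2) bound that] by (simp add: flow)
  have "norm ((flow f x t - t *\<^sub>R f x) - (flow f x 0 - 0 *\<^sub>R f x)) \<le> (L1 * (L0 * t)) * t"
  proof (rule norm_increment_le[where u = "\<lambda>s. flow f x s - s *\<^sub>R f x"])
    show "((\<lambda>s. flow f x s - s *\<^sub>R f x) has_vector_derivative f (flow f x s) - f x) (at s)" for s
      using flow(2)[of x s] by (auto intro!: derivative_eq_intros)
    fix s assume "0 \<le> s" "s \<le> t"
    have "norm (f (flow f x s) - f x) \<le> L1 * norm (flow f x s - x)"
      by (rule smooth_class_lipschitz[OF f])
    also have "norm (flow f x s - x) \<le> L0 * t"
      using *[OF \<open>0 \<le> s\<close>] mult_left_mono[OF \<open>s \<le> t\<close> L0] by linarith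
    finally show "norm (f (flow f x s) - f x) \<le> L1 * (L0 * t)"
      using \<open>L1 > 0\<close> by simp
  qed (use \<open>t \<ge> 0\<close> in auto)
  then show ?thesis
    by (simp add: flow algebra_simps power2_eq_square)
qed

section \<open>Weighted means of independent noise\<close>

text \<open>The weighted residuals around the weighted mean \<open>m\<close> sum to zero, so by
  Pythagoras the objective at \<open>t\<close> exceeds its value at \<open>m\<close> by exactly
  \<open>s * (norm (m - t))\<^sup>2\<close>. As \<open>s > 0\<close>, a minimiser must equal
  \<open>m\<close>.\<close>

lemma is_local_constant_fit_eq_weighted_mean:
  fixes z :: "nat \<Rightarrow> 'a::real_inner"
  assumes fit: "is_local_constant_fit K h n x z y \<theta>"
    and pos: "(\<Sum>j=1..n. K (norm (x j - y) / h)) > 0"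
  shows "\<theta> = (\<Sum>j=1..n. K (norm (x j - y) / h) *\<^sub>R z j) /\<^sub>R (\<Sum>j=1..n. K (norm (x j - y) / h))"
proof -
  define k where "k j = K (norm (x j - y) / h)" for j
  define s where "s = (\<Sum>j=1..n. k j)"
  define m where "m = (\<Sum>j=1..n. k j *\<^sub>R z j) /\<^sub>R s"
  have s: "s > 0"
    using pos by (simp add: s_def k_def)
  have centred: "(\<Sum>j=1..n. k j *\<^sub>R (z j - m)) = 0"
  proof -
    have "(\<Sum>j=1..n. k j *\<^sub>R (z j - m)) = (\<Sum>j=1..n. k j *\<^sub>R z j) - s *\<^sub>R m"
      by (simp add: scaleR_diff_right sum_subtractf s_def scaleR_sum_left)
    then show ?thesis
      using s by (simp add: m_def)
  qed
  have decomp: "(\<Sum>j=1..n. (norm (z j - t))\<^sup>2 * k j)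
      = (\<Sum>j=1..n. (norm (z j - m))\<^sup>2 * k j) + s * (norm (m - t))\<^sup>2" for t
  proof -
    have "(norm (z j - t))\<^sup>2 * k j = (norm (z j - m))\<^sup>2 * k j
        + (2 * ((k j *\<^sub>R (z j - m)) \<bullet> (m - t)) + k j * (norm (m - t))\<^sup>2)" for j
    proof -
      have "(norm (u + v))\<^sup>2 = (norm u)\<^sup>2 + 2 * (u \<bullet> v) + (norm v)\<^sup>2" for u v :: 'a
        by (simp add: power2_norm_eq_inner inner_add_left inner_add_right inner_commute)
      from this[of "z j - m" "m - t"] have "(norm (z j - t))\<^sup>2
          = (norm (z j - m))\<^sup>2 + 2 * ((z j - m) \<bullet> (m - t)) + (norm (m - t))\<^sup>2"
        by simp
      then show ?thesis
        by (simp only: inner_scaleR_left) (simp only: ring_distribs mult_ac)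
    qed
    then have "(\<Sum>j=1..n. (norm (z j - t))\<^sup>2 * k j) = (\<Sum>j=1..n. (norm (z j - m))\<^sup>2 * k j)
        + (2 * ((\<Sum>j=1..n. k j *\<^sub>R (z j - m)) \<bullet> (m - t)) + s * (norm (m - t))\<^sup>2)"
      by (simp only: sum.distrib s_def inner_sum_left sum_distrib_left sum_distrib_right)
    then show ?thesis
      by (simp only: centred) simp
  qed
  have "\<not> (\<Sum>j=1..n. (norm (z j - m))\<^sup>2 * k j) < (\<Sum>j=1..n. (norm (z j - \<theta>))\<^sup>2 * k j)"
    using fit by (simp add: is_local_constant_fit_def is_arg_min_def k_def)
  then have "s * (norm (m - \<theta>))\<^sup>2 \<le> 0"
    unfolding decomp[of \<theta>] by linarith
  then have "m = \<theta>"
    using s by (simp add: mult_le_0_iff)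
  then show ?thesis
    by (simp add: m_def s_def k_def)
qed

context prob_space
begin

text \<open>Reduction to real random variables: the inner product is a finite sum over the basis of
  products of coordinates, and the coordinates of \<open>\<epsilon> i\<close> and
  \<open>\<epsilon> j\<close> are independent and integrable.\<close>

lemma indep_inner_expectation:
  fixes \<epsilon> :: "'i \<Rightarrow> 'a \<Rightarrow> 'b::euclidean_space"
  assumes indep: "indep_vars (\<lambda>_. borel) \<epsilon> I" and ij: "i \<in> I" "j \<in> I" "i \<noteq> j"
    and int: "\<And>i. i \<in> I \<Longrightarrow> integrable M (\<epsilon> i)"
  shows "integrable M (\<lambda>\<omega>. \<epsilon> i \<omega> \<bullet> \<epsilon> j \<omega>)"
    and "expectation (\<lambda>\<omega>. \<epsilon> i \<omega> \<bullet> \<epsilon> j \<omega>) = expectation (\<epsilon> i) \<bullet> expectation (\<epsilon> j)"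
proof -
  have indep_b: "indep_vars (\<lambda>_. borel) (\<lambda>i \<omega>. \<epsilon> i \<omega> \<bullet> b) {i, j}" for b
    by (rule indep_vars_compose2[where Y = "\<lambda>_ v. v \<bullet> b" and M' = "\<lambda>_. borel"])
      (use indep_vars_subset[OF indep, of "{i, j}"] ij in auto)
  have int_b: "integrable M (\<lambda>\<omega>. \<epsilon> k \<omega> \<bullet> b)" if "k \<in> {i, j}" for k b
    using that ij by (auto intro!: integrable_inner_left int)
  have *: "integrable M (\<lambda>\<omega>. (\<epsilon> i \<omega> \<bullet> b) * (\<epsilon> j \<omega> \<bullet> b))" for b
    using indep_vars_integrable[OF _ indep_b[of b] int_b[of _ b]] ij by simp
  then show "integrable M (\<lambda>\<omega>. \<epsilon> i \<omega> \<bullet> \<epsilon> j \<omega>)"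
    by (subst euclidean_inner) auto
  have "expectation (\<lambda>\<omega>. (\<epsilon> i \<omega> \<bullet> b) * (\<epsilon> j \<omega> \<bullet> b))
      = (expectation (\<epsilon> i) \<bullet> b) * (expectation (\<epsilon> j) \<bullet> b)" for b
    using indep_vars_lebesgue_integral[OF _ indep_b[of b] int_b[of _ b]] ij int by simp
  then show "expectation (\<lambda>\<omega>. \<epsilon> i \<omega> \<bullet> \<epsilon> j \<omega>) = expectation (\<epsilon> i) \<bullet> expectation (\<epsilon> j)"
    using * by (subst (1 2) euclidean_inner) simp
qed

text \<open>Expanding the square gives a double sum of inner products. The terms with
  \<open>i \<noteq> j\<close> have expectation zero by independence and centring, so only the
  diagonal survives.\<close>

lemma expectation_norm_sum_indep:
  fixes \<epsilon> :: "'i \<Rightarrow> 'a \<Rightarrow> 'b::euclidean_space"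
  assumes "finite I" and indep: "indep_vars (\<lambda>_. borel) \<epsilon> I"
    and int: "\<And>i. i \<in> I \<Longrightarrow> integrable M (\<epsilon> i)" and mean: "\<And>i. i \<in> I \<Longrightarrow> expectation (\<epsilon> i) = 0"
    and sq: "\<And>i. i \<in> I \<Longrightarrow> integrable M (\<lambda>\<omega>. (norm (\<epsilon> i \<omega>))\<^sup>2)"
  shows "integrable M (\<lambda>\<omega>. (norm (\<Sum>i\<in>I. w i *\<^sub>R \<epsilon> i \<omega>))\<^sup>2)"
    and "expectation (\<lambda>\<omega>. (norm (\<Sum>i\<in>I. w i *\<^sub>R \<epsilon> i \<omega>))\<^sup>2)
      = (\<Sum>i\<in>I. (w i)\<^sup>2 * expectation (\<lambda>\<omega>. (norm (\<epsilon> i \<omega>))\<^sup>2))"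
proof -
  have expand: "(norm (\<Sum>i\<in>I. w i *\<^sub>R \<epsilon> i \<omega>))\<^sup>2
      = (\<Sum>i\<in>I. \<Sum>j\<in>I. w i * w j * (\<epsilon> i \<omega> \<bullet> \<epsilon> j \<omega>))" for \<omega>
    by (simp only: power2_norm_eq_inner inner_sum_left inner_sum_right inner_scaleR_left
        inner_scaleR_right sum_distrib_left mult_ac) (simp only: inner_commute)
  \<comment> \<open>On the diagonal this is square integrability; off the diagonal it comes from
    independence.\<close>
  have int2: "integrable M (\<lambda>\<omega>. w i * w j * (\<epsilon> i \<omega> \<bullet> \<epsilon> j \<omega>))" if "i \<in> I" "j \<in> I" for i j
    using that indep_inner_expectation(1)[OF indep that _ int] sq
    by (cases "i = j") (auto simp: power2_norm_eq_inner)
  show "integrable M (\<lambda>\<omega>. (norm (\<Sum>i\<in>I. w i *\<^sub>R \<epsilon> i \<omega>))\<^sup>2)"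
    unfolding expand by (intro Bochner_Integration.integrable_sum int2)
  have "expectation (\<lambda>\<omega>. (norm (\<Sum>i\<in>I. w i *\<^sub>R \<epsilon> i \<omega>))\<^sup>2)
      = (\<Sum>i\<in>I. \<Sum>j\<in>I. expectation (\<lambda>\<omega>. w i * w j * (\<epsilon> i \<omega> \<bullet> \<epsilon> j \<omega>)))"
    unfolding expand
    by (simp only: Bochner_Integration.integral_sum int2 Bochner_Integration.integrable_sum cong: sum.cong)
  also have "\<dots> = (\<Sum>i\<in>I. \<Sum>j\<in>I. if i = j then (w i)\<^sup>2 * expectation (\<lambda>\<omega>. (norm (\<epsilon> i \<omega>))\<^sup>2) else 0)"
    using indep_inner_expectation(2)[OF indep _ _ _ int] mean
    by (intro sum.cong) (auto simp: power2_norm_eq_inner power2_eq_square[of "w _"])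
  finally show "expectation (\<lambda>\<omega>. (norm (\<Sum>i\<in>I. w i *\<^sub>R \<epsilon> i \<omega>))\<^sup>2)
      = (\<Sum>i\<in>I. (w i)\<^sup>2 * expectation (\<lambda>\<omega>. (norm (\<epsilon> i \<omega>))\<^sup>2))"
    using \<open>finite I\<close> by simp
qed

end

section \<open>Grid points in an annulus\<close>

lemma finite_unif_grid: "finite (unif_grid m :: (real ^ 'd) set)"
proof (rule finite_surj)
  let ?g = "\<lambda>\<phi>. \<chi> i. real (\<phi> i) / real m"
  show "finite ((UNIV :: 'd set) \<rightarrow>\<^sub>E {1..m})"
    by (simp add: finite_PiE)
  show "(unif_grid m :: (real ^ 'd) set) \<subseteq> ?g ` (UNIV \<rightarrow>\<^sub>E {1..m})"
  proof
    fix p :: "real ^ 'd" assume "p \<in> unif_grid m"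
    then obtain \<phi> where "\<And>i. \<phi> i \<in> {1..m} \<and> p $ i = real (\<phi> i) / real m"
      unfolding unif_grid_def mem_Collect_eq Bex_def by metis
    then show "p \<in> ?g ` (UNIV \<rightarrow>\<^sub>E {1..m})"
      by (intro image_eqI[of _ _ \<phi>]) (auto simp: vec_eq_iff)
  qed
qed

text \<open>The scaling by \<open>sqrt CARD('d)\<close> is chosen so that \<open>CARD('d)\<close>
  equal squares \<open>(c / sqrt CARD('d))\<^sup>2\<close> add up to \<open>c\<^sup>2\<close>. It
  allows coordinatewise conditions to place a point in a Euclidean annulus.\<close>

lemma norm_vec_between:
  fixes v :: "real ^ 'd"
  assumes "0 \<le> a" and "\<And>i. a / sqrt CARD('d) \<le> \<bar>v $ i\<bar>" and "\<And>i. \<bar>v $ i\<bar> \<le> b / sqrt CARD('d)"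
  shows "a \<le> norm v" and "norm v \<le> b"
proof -
  have b: "0 \<le> b"
    using order_trans[OF abs_ge_zero assms(3)] by (simp add: zero_le_divide_iff)
  have sum: "(\<Sum>i\<in>(UNIV::'d set). (c / sqrt CARD('d))\<^sup>2) = c\<^sup>2" for c :: real
    by (simp add: power_divide)
  have norm: "norm v = sqrt (\<Sum>i\<in>UNIV. \<bar>v $ i\<bar>\<^sup>2)"
    by (simp add: norm_vec_def L2_set_def)
  have "a\<^sup>2 \<le> (\<Sum>i\<in>UNIV. \<bar>v $ i\<bar>\<^sup>2)"
    using assms(1,2) by (subst sum[of a, symmetric], intro sum_mono power_mono) auto
  then show "a \<le> norm v"
    unfolding norm by (rule real_le_rsqrt)
  have "(\<Sum>i\<in>UNIV. \<bar>v $ i\<bar>\<^sup>2) \<le> b\<^sup>2"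
    using assms(3) by (subst sum[of b, symmetric], intro sum_mono power_mono) auto
  then show "norm v \<le> b"
    unfolding norm using b by (intro real_le_lsqrt) auto
qed

text \<open>In every coordinate one of the two directions stays inside \<open>[0, 1]\<close> up to distance \<open>b \<le> 1/2\<close>.
  The points whose coordinates all have distance between \<open>a / sqrt d\<close> and \<open>b / sqrt d\<close> in these
  directions form a cube inside the annulus, and the grid points of that cube are counted.\<close>

lemma card_unif_grid_annulus:
  fixes y :: "real ^ 'd"
  assumes y: "\<And>i. y $ i \<in> {0..1}" and ab: "0 \<le> a" "a < b" "b \<le> 1/2" and "m \<ge> 1"
    and l: "1 \<le> real m * ((b - a) / sqrt CARD('d))"
  shows "(real m * ((b - a) / sqrt CARD('d)) - 1) ^ CARD('d)
    \<le> real (card {p \<in> unif_grid m. a \<le> norm (p - y) \<and> norm (p - y) \<le> b})" (is "_ \<le> real (card ?P)")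
proof -
  define r where "r = sqrt (real CARD('d))"
  have r: "r \<ge> 1"
    by (simp add: r_def Suc_leI)
  define \<alpha> \<beta> where "\<alpha> = a / r" and "\<beta> = b / r"
  define lo where "lo i = (if y $ i \<le> 1/2 then y $ i + \<alpha> else y $ i - \<beta>)" for i
  define hi where "hi i = lo i + (\<beta> - \<alpha>)" for i
  have \<beta>: "\<beta> \<le> 1/2"
    using r ab by (simp add: \<beta>_def field_simps)
  have \<alpha>: "0 \<le> \<alpha>" "\<alpha> < \<beta>"
    using r ab by (simp_all add: \<alpha>_def \<beta>_def divide_strict_right_mono)
  have lo: "0 \<le> lo i" for i
    using y[of i] \<alpha> \<beta> by (auto simp: lo_def)
  have hi: "hi i \<le> 1" for i
    using y[of i] \<alpha> \<beta> by (auto simp: hi_def lo_def)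
  have near: "\<alpha> \<le> \<bar>t - y $ i\<bar>" "\<bar>t - y $ i\<bar> \<le> \<beta>" if "lo i \<le> t" "t \<le> hi i" for t i
    using that \<alpha> by (auto simp: hi_def lo_def split: if_splits)
  \<comment> \<open>The indices \<open>k\<close> with
    \<open>real m * lo i < k \<le> real m * hi i\<close>. Excluding the lower end forces
    \<open>k \<ge> 1\<close>, as grid indices require; rounding costs at most one index per
    coordinate.\<close>
  define A where "A i = {nat \<lfloor>real m * lo i\<rfloor><..nat \<lfloor>real m * hi i\<rfloor>}" for i
  have A: "lo i \<le> real k / real m \<and> real k / real m \<le> hi i \<and> k \<in> {1..m}" if "k \<in> A i" for k i
  proof -
    have "real m * lo i < real k"
      using that by (simp add: A_def) linarith
    moreover have "real k \<le> real m * hi i"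
      using that by (simp add: A_def) linarith
    moreover have "real m * hi i \<le> real m * 1"
      using hi[of i] by (intro mult_left_mono) auto
    moreover have "1 \<le> k"
      using that by (simp add: A_def)
    moreover from calculation have "k \<le> m"
      by linarith
    ultimately show ?thesis
      using \<open>m \<ge> 1\<close>
      by (simp add: pos_le_divide_eq pos_divide_le_eq mult.commute)
  qed
  have card_A: "real m * (\<beta> - \<alpha>) - 1 \<le> real (card (A i))" for i
  proof -
    have "real m * (\<beta> - \<alpha>) = real m * hi i - real m * lo i"
      by (simp add: hi_def algebra_simps)
    moreover have "0 \<le> real m * lo i"
      using lo[of i] by simp
    moreover have "real m * lo i \<le> real m * hi i"
      using \<alpha> by (intro mult_left_mono) (auto simp: hi_def)
    ultimately show ?thesis
      unfolding A_def card_greaterThanAtMost by linarith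
  qed
  let ?g = "\<lambda>\<phi>. \<chi> i. real (\<phi> i) / real m"
  have side: "(b - a) / sqrt CARD('d) = \<beta> - \<alpha>"
    by (simp add: \<alpha>_def \<beta>_def r_def diff_divide_distrib)
  have "(real m * (\<beta> - \<alpha>) - 1) ^ CARD('d) = (\<Prod>i\<in>(UNIV::'d set). real m * (\<beta> - \<alpha>) - 1)"
    by simp
  \<comment> \<open>Monotonicity of the product needs nonnegative factors, which is what assumption
    \<open>l\<close> provides.\<close>
  also have "\<dots> \<le> (\<Prod>i\<in>UNIV. real (card (A i)))"
    using l card_A by (intro prod_mono) (auto simp: side)
  also have "\<dots> = real (card (PiE UNIV A))"
    by (subst card_PiE) auto
  also have "card (PiE UNIV A) = card (?g ` PiE UNIV A)"
  proof (rule card_image[symmetric], rule inj_onI)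
    fix \<phi> \<psi> assume "?g \<phi> = ?g \<psi>"
    then show "\<phi> = \<psi>"
      using \<open>m \<ge> 1\<close> by (auto simp: vec_eq_iff fun_eq_iff)
  qed
  also have "real (card (?g ` PiE UNIV A)) \<le> real (card ?P)"
    unfolding of_nat_le_iff
  proof (rule card_mono)
    show "finite ?P"
      using finite_unif_grid by (rule rev_finite_subset) auto
    show "?g ` PiE UNIV A \<subseteq> ?P"
    proof
      fix p assume "p \<in> ?g ` PiE UNIV A"
      then obtain \<phi> where "\<phi> \<in> PiE UNIV A" "p = ?g \<phi>"
        by blast
      then have \<phi>: "\<And>i. \<phi> i \<in> A i" "\<And>i. p $ i = real (\<phi> i) / real m"
        by auto
      then have "p \<in> unif_grid m"
        using A by (auto simp: unif_grid_def)
      moreover have "a / sqrt CARD('d) \<le> \<bar>(p - y) $ i\<bar>" "\<bar>(p - y) $ i\<bar> \<le> b / sqrt CARD('d)" for i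
        using near[of i "real (\<phi> i) / real m"] A[OF \<phi>(1), of i] by (auto simp: \<phi>(2) \<alpha>_def \<beta>_def r_def)
      ultimately show "p \<in> ?P"
        using norm_vec_between[of a "p - y" b] ab by simp
    qed
  qed
  finally show ?thesis
    by (simp only: side)
qed

section \<open>Asymptotic order and kernels\<close>

text \<open>A finite limsup lies strictly below some positive real \<open>C\<close>, so the ratio is
  eventually below \<open>C\<close>; positivity of \<open>b\<close> then clears the
  denominator.\<close>

lemma asymp_le_ennrealD:
  assumes "(\<lambda>k. ennreal (a k)) \<preceq> (\<lambda>k. ennreal (b k))" and "eventually (\<lambda>k. b k > 0) sequentially"
  shows "\<exists>C>0. eventually (\<lambda>k. a k \<le> C * b k) sequentially"
proof -
  obtain C where C: "limsup (\<lambda>k. ennreal (a k) / ennreal (b k)) < ennreal C" "C > 0"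
  proof -
    have "limsup (\<lambda>k. ennreal (a k) / ennreal (b k)) < top"
      using assms(1) by (simp add: asymp_le_def)
    then obtain r where "0 \<le> r" "limsup (\<lambda>k. ennreal (a k) / ennreal (b k)) = ennreal r"
      by (cases "limsup (\<lambda>k. ennreal (a k) / ennreal (b k))") auto
    then show ?thesis
      by (intro that[of "r + 1"]) (auto simp: ennreal_less_iff)
  qed
  from Limsup_lessD[OF C(1)] assms(2) have "eventually (\<lambda>k. a k \<le> C * b k) sequentially"
  proof eventually_elim
    case (elim k)
    then have "ennreal (a k) < ennreal (C * b k)"
      using \<open>C > 0\<close> by (subst (asm) divide_less_ennreal) (auto simp: ennreal_mult)
    \<comment> \<open>Since \<open>ennreal\<close> sends negative reals to 0, a negative
      \<open>a k\<close> is handled separately: there the bound holds because \<open>C * b k\<close>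
      is nonnegative.\<close>
    then show ?case
      using elim \<open>C > 0\<close> by (cases "a k \<ge> 0") (auto simp: ennreal_less_iff intro: order_trans[OF _ mult_nonneg_nonneg])
  qed
  with C show ?thesis
    by blast
qed

text \<open>The left sequence keeps its values in \<open>ennreal\<close>, since it will be a risk
  given as a nonnegative integral.\<close>

lemma asymp_le_ennrealI:
  assumes "eventually (\<lambda>k. b k > 0 \<and> a k \<le> ennreal (C * b k)) sequentially" and "C \<ge> 0"
  shows "a \<preceq> (\<lambda>k. ennreal (b k))"
proof -
  have "eventually (\<lambda>k. a k / ennreal (b k) \<le> ennreal C) sequentially"
    using assms(1)
  proof eventually_elim
    case (elim k)
    then have "a k / ennreal (b k) \<le> ennreal (C * b k) / ennreal (b k)"
      by (intro divide_right_mono_ennreal) auto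
    also have "\<dots> = ennreal C"
      using elim \<open>C \<ge> 0\<close> by (subst divide_ennreal) auto
    finally show ?case .
  qed
  then have "limsup (\<lambda>k. a k / ennreal (b k)) \<le> ennreal C"
    by (rule Limsup_bounded)
  then show ?thesis
    unfolding asymp_le_def infinity_ennreal_def using ennreal_less_top le_less_trans by blast
qed

lemma nw_kernel_bounds:
  assumes "nw_kernel K"
  obtains a b c C where "0 \<le> a" "a < b" "c > 0" "\<And>z. a \<le> z \<Longrightarrow> z \<le> b \<Longrightarrow> c \<le> K z"
    "C > 0" "\<And>z. z \<ge> 0 \<Longrightarrow> 0 \<le> K z \<and> K z \<le> C" "\<And>z. z > 1 \<Longrightarrow> K z = 0"
proof -
  from assms obtain L C a where L: "L-lipschitz_on {0..} K" and nonneg: "\<And>z. z \<ge> 0 \<Longrightarrow> K z \<ge> 0"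
    and a: "a \<ge> 0" "K a \<noteq> 0" and C: "C > 0" "\<And>z. z \<ge> 0 \<Longrightarrow> K z \<le> C * indicator {0..1} z"
    unfolding nw_kernel_def by blast
  have "K a > 0" and "L \<ge> 0"
    using a nonneg[of a] L by (auto simp: lipschitz_on_def)
  \<comment> \<open>To the right of a point \<open>a\<close> with \<open>K a > 0\<close>, the
    Lipschitz condition lets \<open>K\<close> lose at most half of \<open>K a\<close> over this
    length. The summand 1 keeps the denominator positive when \<open>L = 0\<close>.\<close>
  define b where "b = a + K a / (2 * (L + 1))"
  show ?thesis
  proof (rule that)
    show "0 \<le> a" "a < b" "0 < K a / 2"
      using a \<open>K a > 0\<close> \<open>L \<ge> 0\<close> by (simp_all add: b_def)
    show "K a / 2 \<le> K z" if "a \<le> z" "z \<le> b" for z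
    proof -
      have "\<bar>K a - K z\<bar> \<le> L * \<bar>a - z\<bar>"
        using lipschitz_onD[OF L, of a z] that a by (simp add: dist_real_def)
      also have "\<dots> \<le> (L + 1) * (b - a)"
        using that \<open>L \<ge> 0\<close> by (intro mult_mono) auto
      also have "\<dots> = K a / 2"
        using \<open>L \<ge> 0\<close> by (simp add: b_def field_simps)
      finally show ?thesis
        by linarith
    qed
    show "C > 0" by fact
    show "0 \<le> K z \<and> K z \<le> C" if "z \<ge> 0" for z
      using C(1) C(2)[OF that] nonneg[OF that] that by (cases "z \<le> 1") auto
    show "K z = 0" if "z > 1" for z
      using C(2)[of z] nonneg[of z] that by (auto simp: indicator_def)
  qed
qed

section \<open>Risk of the local constant estimator\<close>

text \<open>A bound for one fixed sample size with explicit constants. The first summand is the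
  squared bias from flow curvature and bandwidth; the second is the noise variance, controlled by
  the largest weight, because squared weights sum to at most the largest weight when the weights sum
  to 1.\<close>

lemma (in prob_space) local_constant_risk_bound:
  fixes f :: "real ^ 'd \<Rightarrow> real ^ 'd" and x :: "nat \<Rightarrow> real ^ 'd" and \<epsilon> :: "nat \<Rightarrow> 'a \<Rightarrow> real ^ 'd"
    and m :: nat
  defines "N \<equiv> m ^ CARD('d)"
  assumes f: "f \<in> smooth_class L0 L1" and "L1 > 0" and "m \<ge> 1" and x: "x ` {1..N} = unif_grid m"
    and indep: "indep_vars (\<lambda>_. borel) \<epsilon> {1..N}"
    and mean: "\<And>j. j \<in> {1..N} \<Longrightarrow> integrable M (\<epsilon> j) \<and> expectation (\<epsilon> j) = 0"
    and variance: "\<And>j. j \<in> {1..N} \<Longrightarrow> integrable M (\<lambda>\<omega>. (norm (\<epsilon> j \<omega>))\<^sup>2) \<and>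
      expectation (\<lambda>\<omega>. (norm (\<epsilon> j \<omega>))\<^sup>2) \<le> \<sigma>\<^sup>2"
    and fit: "\<And>\<omega>. \<omega> \<in> space M \<Longrightarrow>
      is_local_constant_fit K h N x (\<lambda>j. flow f (x j) t + \<epsilon> j \<omega> - x j) y (\<theta> \<omega>)"
    and "t > 0" and "h > 0" and y: "\<And>i. y $ i \<in> {0..1}"
    and ab: "0 \<le> a" "a < b" and "c > 0" and K_ge: "\<And>z. a \<le> z \<Longrightarrow> z \<le> b \<Longrightarrow> c \<le> K z"
    and K: "\<And>z. z \<ge> 0 \<Longrightarrow> 0 \<le> K z \<and> K z \<le> C" and K0: "\<And>z. z > 1 \<Longrightarrow> K z = 0"
    and hb: "h * b \<le> 1/2" and ml: "2 \<le> real m * (h * ((b - a) / sqrt CARD('d)))"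
  shows "(\<integral>\<^sup>+\<omega>. ennreal ((norm (\<theta> \<omega> /\<^sub>R t - f y))\<^sup>2) \<partial>M)
    \<le> ennreal (2 * (L1 * (L0 * t + h))\<^sup>2 + 2 * (\<sigma>\<^sup>2 / t\<^sup>2 *
        (C / (c * ((real m * h) * ((b - a) / (2 * sqrt CARD('d)))) ^ CARD('d)))))"
proof -
  define k where "k j = K (norm (x j - y) / h)" for j
  define S where "S = (\<Sum>j=1..N. k j)"
  define s where "s = c * ((real m * h) * ((b - a) / (2 * sqrt CARD('d)))) ^ CARD('d)"
  have k: "0 \<le> k j" "k j \<le> C" for j
    using K[of "norm (x j - y) / h"] \<open>h > 0\<close> by (auto simp: k_def)
  have s: "s > 0"
    using \<open>c > 0\<close> \<open>h > 0\<close> \<open>m \<ge> 1\<close> ab by (simp add: s_def)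
  have "s \<le> S"
  proof -
    \<comment> \<open>On this annulus the kernel argument lies in \<open>{a..b}\<close>, so each of
      its grid points contributes at least \<open>c\<close> to \<open>S\<close>.\<close>
    define P where "P = {p \<in> unif_grid m. h * a \<le> norm (p - y) \<and> norm (p - y) \<le> h * b}"
    define J where "J = {j \<in> {1..N}. x j \<in> P}"
    \<comment> \<open>Assumption \<open>ml\<close> absorbs the index lost to rounding into a factor
      2, which appears in \<open>s\<close>.\<close>
    have half: "X / 2 \<le> X - 1" if "2 \<le> X" for X :: real
      using that by linarith
    have side: "(h * b - h * a) / sqrt CARD('d) = h * ((b - a) / sqrt CARD('d))"
      by (simp add: algebra_simps)
    have side_ge: "1 \<le> real m * ((h * b - h * a) / sqrt CARD('d))"
      unfolding side using ml by linarith
    have "((real m * h) * ((b - a) / (2 * sqrt CARD('d)))) ^ CARD('d)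
        \<le> (real m * (h * ((b - a) / sqrt CARD('d))) - 1) ^ CARD('d)"
    proof (rule power_mono)
      have "(real m * h) * ((b - a) / (2 * sqrt CARD('d))) = real m * (h * ((b - a) / sqrt CARD('d))) / 2"
        by simp
      then show "(real m * h) * ((b - a) / (2 * sqrt CARD('d))) \<le> real m * (h * ((b - a) / sqrt CARD('d))) - 1"
        using half[OF ml] by (simp only:)
    qed (use \<open>h > 0\<close> ab in auto)
    also have "\<dots> \<le> real (card P)"
      using card_unif_grid_annulus[OF y _ _ hb \<open>m \<ge> 1\<close> side_ge] \<open>h > 0\<close> ab
      unfolding side P_def by simp
    also have "card P \<le> card J"
    proof (rule surj_card_le)
      show "P \<subseteq> x ` J"
      proof
        fix p assume "p \<in> P"
        then have "p \<in> x ` {1..N}"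
          unfolding x P_def by simp
        with \<open>p \<in> P\<close> show "p \<in> x ` J"
          by (auto simp: J_def)
      qed
    qed (simp add: J_def)
    finally have "s \<le> (\<Sum>j\<in>J. c)"
      using \<open>c > 0\<close> by (simp add: s_def mult.commute)
    also have "\<dots> \<le> (\<Sum>j\<in>J. k j)"
    proof (rule sum_mono)
      fix j assume "j \<in> J"
      then show "c \<le> k j"
        using \<open>h > 0\<close> unfolding k_def
        by (intro K_ge) (auto simp: J_def P_def pos_le_divide_eq pos_divide_le_eq mult.commute)
    qed
    also have "\<dots> \<le> S"
      unfolding S_def by (rule sum_mono2) (auto simp: J_def k)
    finally show ?thesis .
  qed
  then have S: "S > 0"
    using s by linarith
  define w where "w j = k j / S" for j
  have w: "0 \<le> w j" "w j \<le> C / s" for j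
  proof -
    show "0 \<le> w j"
      using k S by (simp add: w_def)
    show "w j \<le> C / s"
      unfolding w_def using k[of j] s \<open>s \<le> S\<close> by (intro frac_le) linarith+
  qed
  have w_sum: "(\<Sum>j=1..N. w j) = 1"
    using S by (simp add: w_def S_def flip: sum_divide_distrib)
  define B where "B = L1 * (L0 * t + h)"
  define bias where "bias = (\<Sum>j=1..N. w j *\<^sub>R ((flow f (x j) t - x j) /\<^sub>R t - f y))"
  define noise where "noise \<omega> = (\<Sum>j=1..N. (w j / t) *\<^sub>R \<epsilon> j \<omega>)" for \<omega>
  have bias: "norm bias \<le> B"
  proof -
    \<comment> \<open>Within distance \<open>h\<close> of \<open>y\<close> the error splits into the
      flow approximation at \<open>x j\<close> and the variation of \<open>f\<close> between
      \<open>x j\<close> and \<open>y\<close>; farther away the weight vanishes.\<close>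
    have "norm (w j *\<^sub>R ((flow f (x j) t - x j) /\<^sub>R t - f y)) \<le> w j * B" for j
    proof (cases "norm (x j - y) \<le> h")
      case True
      have "(flow f (x j) t - x j) /\<^sub>R t - f y
          = (flow f (x j) t - x j - t *\<^sub>R f (x j)) /\<^sub>R t + (f (x j) - f y)"
        using \<open>t > 0\<close> by (simp add: scaleR_diff_right)
      also have "norm \<dots> \<le> norm (flow f (x j) t - x j - t *\<^sub>R f (x j)) / t + norm (f (x j) - f y)"
        using \<open>t > 0\<close> by (intro order_trans[OF norm_triangle_ineq]) (simp add: divide_inverse mult.commute)
      also have "\<dots> \<le> (L0 * L1 * t\<^sup>2) / t + L1 * h"
      proof (rule add_mono)
        show "norm (flow f (x j) t - x j - t *\<^sub>R f (x j)) / t \<le> (L0 * L1 * t\<^sup>2) / t"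
          using flow_increment_approx[OF f \<open>L1 > 0\<close>, of t "x j"] \<open>t > 0\<close> by (simp add: divide_right_mono)
        show "norm (f (x j) - f y) \<le> L1 * h"
          using smooth_class_lipschitz[OF f, of "x j" y] mult_left_mono[OF True, of L1] \<open>L1 > 0\<close> by linarith
      qed
      also have "\<dots> = B"
        using \<open>t > 0\<close> by (simp add: B_def power2_eq_square algebra_simps)
      finally show ?thesis
        using w by (simp add: mult_left_mono)
    next
      case False
      then have "w j = 0"
        using K0 \<open>h > 0\<close> by (simp add: w_def k_def)
      then show ?thesis
        by simp
    qed
    then have "norm bias \<le> (\<Sum>j=1..N. w j * B)"
      unfolding bias_def by (intro order_trans[OF norm_sum] sum_mono)
    also have "\<dots> = B"
      using w_sum by (simp flip: sum_distrib_right)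
    finally show ?thesis .
  qed
  \<comment> \<open>As the weights sum to 1, \<open>f y\<close> can be moved inside the weighted
    mean.\<close>
  have decomp: "\<theta> \<omega> /\<^sub>R t - f y = bias + noise \<omega>" if "\<omega> \<in> space M" for \<omega>
  proof -
    have "\<theta> \<omega> = (\<Sum>j=1..N. k j *\<^sub>R (flow f (x j) t + \<epsilon> j \<omega> - x j)) /\<^sub>R S"
      using is_local_constant_fit_eq_weighted_mean[OF fit[OF that]] S
      by (simp add: k_def S_def)
    also have "\<dots> = (\<Sum>j=1..N. w j *\<^sub>R (flow f (x j) t + \<epsilon> j \<omega> - x j))"
      by (simp add: w_def scaleR_sum_right divide_inverse mult.commute)
    finally have "\<theta> \<omega> /\<^sub>R t - f y
        = (\<Sum>j=1..N. w j *\<^sub>R (flow f (x j) t + \<epsilon> j \<omega> - x j)) /\<^sub>R t - (\<Sum>j=1..N. w j) *\<^sub>R f y"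
      by (simp only: w_sum scaleR_one)
    also have "\<dots> = (\<Sum>j=1..N. w j *\<^sub>R ((flow f (x j) t - x j) /\<^sub>R t - f y) + (w j / t) *\<^sub>R \<epsilon> j \<omega>)"
      by (simp add: scaleR_sum_right scaleR_sum_left divide_inverse algebra_simps flip: sum_subtractf)
    finally show ?thesis
      by (simp only: bias_def noise_def sum.distrib)
  qed
  note noise = expectation_norm_sum_indep[OF _ indep, of "\<lambda>j. w j / t", folded noise_def]
  have noise_int: "integrable M (\<lambda>\<omega>. (norm (noise \<omega>))\<^sup>2)"
    using mean variance by (intro noise(1)) auto
  have "expectation (\<lambda>\<omega>. (norm (noise \<omega>))\<^sup>2)
      = (\<Sum>j=1..N. (w j / t)\<^sup>2 * expectation (\<lambda>\<omega>. (norm (\<epsilon> j \<omega>))\<^sup>2))"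
    using mean variance by (intro noise(2)) auto
  also have "\<dots> \<le> (\<Sum>j=1..N. w j * (\<sigma>\<^sup>2 / t\<^sup>2 * (C / s)))"
  proof (rule sum_mono)
    fix j assume j: "j \<in> {1..N}"
    have "(w j / t)\<^sup>2 * expectation (\<lambda>\<omega>. (norm (\<epsilon> j \<omega>))\<^sup>2) \<le> (w j / t)\<^sup>2 * \<sigma>\<^sup>2"
      using variance[OF j] by (intro mult_left_mono) auto
    also have "\<dots> = w j * (\<sigma>\<^sup>2 / t\<^sup>2 * w j)"
      by (simp add: power2_eq_square)
    \<comment> \<open>Only one factor \<open>w j\<close> is replaced by its upper bound; the other
      is kept so that summation over \<open>j\<close> gives 1.\<close>
    also have "\<dots> \<le> w j * (\<sigma>\<^sup>2 / t\<^sup>2 * (C / s))"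
      using w[of j] by (intro mult_left_mono) auto
    finally show "(w j / t)\<^sup>2 * expectation (\<lambda>\<omega>. (norm (\<epsilon> j \<omega>))\<^sup>2) \<le> w j * (\<sigma>\<^sup>2 / t\<^sup>2 * (C / s))" .
  qed
  also have "\<dots> = \<sigma>\<^sup>2 / t\<^sup>2 * (C / s)"
    using w_sum by (simp only: sum_distrib_right[symmetric] mult_1)
  finally have noise_le: "expectation (\<lambda>\<omega>. (norm (noise \<omega>))\<^sup>2) \<le> \<sigma>\<^sup>2 / t\<^sup>2 * (C / s)" .
  have "(\<integral>\<^sup>+\<omega>. ennreal ((norm (\<theta> \<omega> /\<^sub>R t - f y))\<^sup>2) \<partial>M)
      \<le> (\<integral>\<^sup>+\<omega>. ennreal (2 * B\<^sup>2 + 2 * (norm (noise \<omega>))\<^sup>2) \<partial>M)"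
  proof (rule nn_integral_mono, rule ennreal_leI)
    fix \<omega> assume "\<omega> \<in> space M"
    have "(norm (bias + noise \<omega>))\<^sup>2 \<le> (B + norm (noise \<omega>))\<^sup>2"
      using norm_triangle_ineq[of bias "noise \<omega>"] bias by (intro power_mono) auto
    also have "\<dots> \<le> 2 * B\<^sup>2 + 2 * (norm (noise \<omega>))\<^sup>2"
      using sum_squares_bound[of B "norm (noise \<omega>)"] by (simp add: power2_sum)
    finally show "(norm (\<theta> \<omega> /\<^sub>R t - f y))\<^sup>2 \<le> 2 * B\<^sup>2 + 2 * (norm (noise \<omega>))\<^sup>2"
      by (simp add: decomp[OF \<open>\<omega> \<in> space M\<close>])
  qed
  \<comment> \<open>The pointwise majorant is integrable, so its nonnegative integral is a genuine
    expectation.\<close>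
  also have "\<dots> = ennreal (expectation (\<lambda>\<omega>. 2 * B\<^sup>2 + 2 * (norm (noise \<omega>))\<^sup>2))"
    using noise_int by (intro nn_integral_eq_integral) auto
  also have "expectation (\<lambda>\<omega>. 2 * B\<^sup>2 + 2 * (norm (noise \<omega>))\<^sup>2)
      = 2 * B\<^sup>2 + 2 * expectation (\<lambda>\<omega>. (norm (noise \<omega>))\<^sup>2)"
    using noise_int by (simp add: prob_space)
  also have "ennreal \<dots> \<le> ennreal (2 * B\<^sup>2 + 2 * (\<sigma>\<^sup>2 / t\<^sup>2 * (C / s)))"
    using noise_le by (intro ennreal_leI) linarith
  finally show ?thesis
    by (simp only: B_def s_def)
qed

text \<open>With \<open>\<tau> * q\<close> for the time step and \<open>q powr - (4 + D)\<close> for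
  the sample size, the left side is the optimal bandwidth. The exponents of \<open>q\<close> add up
  to \<open>2 - (4 + D) = - (2 + D)\<close>, so the bandwidth is linear in \<open>q\<close>.\<close>

lemma rescaled_powr:
  fixes q \<tau> D :: real
  assumes "q > 0" "\<tau> > 0" "D > 0"
  shows "((\<tau> * q)\<^sup>2 * q powr - (4 + D)) powr (- 1 / (2 + D)) = \<tau> powr (- 2 / (2 + D)) * q"
proof -
  have "(\<tau> * q)\<^sup>2 * q powr - (4 + D) = \<tau> powr 2 * q powr - (2 + D)"
    using assms by (simp add: power_mult_distrib mult.assoc flip: powr_numeral powr_add)
  moreover have "2 * (- 1 / (2 + D)) = - 2 / (2 + D)" "- (2 + D) * (- 1 / (2 + D)) = 1"
    using \<open>D > 0\<close> by (simp_all add: field_simps)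
  ultimately have "((\<tau> * q)\<^sup>2 * q powr - (4 + D)) powr (- 1 / (2 + D)) = \<tau> powr (- 2 / (2 + D)) * q powr 1"
    by (simp only: powr_mult powr_powr powr_ge_zero)
  then show ?thesis
    using assms by simp
qed

text \<open>All data are sequences indexed by \<open>n0\<close>, so the vector field, the
  probability space and the evaluation point may vary with the sample size.\<close>

theorem corollary3p4:
  fixes L0 L1 \<sigma> :: real and K :: "real \<Rightarrow> real"
    and n :: "nat \<Rightarrow> nat"
    and f :: "nat \<Rightarrow> real ^ 'd \<Rightarrow> real ^ 'd"
    and x :: "nat \<Rightarrow> nat \<Rightarrow> real ^ 'd"
    and M :: "nat \<Rightarrow> 'w measure"
    and \<epsilon> Y :: "nat \<Rightarrow> nat \<Rightarrow> 'w \<Rightarrow> real ^ 'd"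
    and \<Delta>t h :: "nat \<Rightarrow> real"
    and \<iota>_hat f_hat :: "nat \<Rightarrow> 'w \<Rightarrow> real ^ 'd \<Rightarrow> real ^ 'd"
    and x0 :: "nat \<Rightarrow> real ^ 'd"
  assumes "L0 > 0" and "L1 > 0" and "\<sigma> \<ge> 0" and "nw_kernel K"
    and n: "\<And>n0. n n0 = n0 ^ CARD('d)"
    and f: "\<And>n0. n0 \<ge> 1 \<Longrightarrow> f n0 \<in> smooth_class L0 L1"
    and x: "\<And>n0. n0 \<ge> 1 \<Longrightarrow> x n0 ` {1..n n0} = unif_grid n0"
    and M: "\<And>n0. n0 \<ge> 1 \<Longrightarrow> prob_space (M n0)"
    and indep: "\<And>n0. n0 \<ge> 1 \<Longrightarrow>
          prob_space.indep_vars (M n0) (\<lambda>_. borel) (\<epsilon> n0) {1..n n0}"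
    and mean: "\<And>n0 j. n0 \<ge> 1 \<Longrightarrow> j \<in> {1..n n0} \<Longrightarrow>
          integrable (M n0) (\<epsilon> n0 j) \<and> (\<integral>\<omega>. \<epsilon> n0 j \<omega> \<partial>M n0) = 0"
    and variance: "\<And>n0 j. n0 \<ge> 1 \<Longrightarrow> j \<in> {1..n n0} \<Longrightarrow>
          integrable (M n0) (\<lambda>\<omega>. (norm (\<epsilon> n0 j \<omega>))\<^sup>2) \<and>
          (\<integral>\<omega>. (norm (\<epsilon> n0 j \<omega>))\<^sup>2 \<partial>M n0) \<le> \<sigma>\<^sup>2"
    and dt_pos: "\<And>n0. n0 \<ge> 1 \<Longrightarrow> \<Delta>t n0 > 0"
    and Y: "\<And>n0 j \<omega>. Y n0 j \<omega> = flow (f n0) (x n0 j) (\<Delta>t n0) + \<epsilon> n0 j \<omega>"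
    and h_pos: "\<And>n0. n0 \<ge> 1 \<Longrightarrow> h n0 > 0"
    and \<iota>_hat: "\<And>n0 \<omega> y. n0 \<ge> 1 \<Longrightarrow> \<omega> \<in> space (M n0) \<Longrightarrow>
          is_local_constant_fit K (h n0) (n n0) (x n0) (\<lambda>j. Y n0 j \<omega> - x n0 j) y (\<iota>_hat n0 \<omega> y)"
    and h: "(\<lambda>n0. ennreal (h n0)) \<asymp>
          (\<lambda>n0. ennreal (((\<Delta>t n0)\<^sup>2 * real (n n0)) powr (- 1 / (2 + real CARD('d)))))"
    and f_hat: "\<And>n0 \<omega> y. f_hat n0 \<omega> y = \<iota>_hat n0 \<omega> y /\<^sub>R \<Delta>t n0"
    and dt: "(\<lambda>n0. ennreal (\<Delta>t n0)) \<asymp>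
          (\<lambda>n0. ennreal (real (n n0) powr (- 1 / (4 + real CARD('d)))))"
    and x0: "\<And>n0. n0 \<ge> 1 \<Longrightarrow> \<forall>i. x0 n0 $ i \<in> {0..1}"
  shows "(\<lambda>n0. \<integral>\<^sup>+\<omega>. ennreal ((norm (f_hat n0 \<omega> (x0 n0) - f n0 (x0 n0)))\<^sup>2) \<partial>M n0) \<preceq>
         (\<lambda>n0. ennreal (real (n n0) powr (- 2 / (4 + real CARD('d)))))"
proof -

  \<comment> \<open>Identities and limits for the rate \<open>q\<close>\<close>
  define D where "D = real CARD('d)"
  have D: "D > 0"
    by (simp add: D_def)
  \<comment> \<open>\<open>q\<close> is the common order of time step and bandwidth, and its square
    is the claimed rate; \<open>g\<close> is the prescribed order of the bandwidth.\<close>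
  define q where "q m = real (n m) powr (- 1 / (4 + D))" for m
  define g where "g m = ((\<Delta>t m)\<^sup>2 * real (n m)) powr (- 1 / (2 + D))" for m
  have ev: "eventually (\<lambda>m. m \<ge> 1) sequentially"
    by (rule eventually_ge_at_top)
  have n_pos: "n m > 0" if "m \<ge> 1" for m
    using that by (simp add: n)
  have q_pos: "q m > 0" if "m \<ge> 1" for m
    using n_pos[OF that] by (simp add: q_def)
  have n_q: "real (n m) = q m powr - (4 + D)" if "m \<ge> 1" for m
  proof -
    have "- 1 / (4 + D) * - (4 + D) = 1"
      using D by (simp add: field_simps)
    then show ?thesis
      using n_pos[OF that] by (simp only: q_def powr_powr) simp
  qed
  have q_eq: "q m = real m powr (- D / (4 + D))" if "m \<ge> 1" for m
  proof -
    have "real (n m) = real m powr D"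
      using that by (simp add: n D_def powr_realpow)
    then show ?thesis
      by (simp add: q_def powr_powr)
  qed
  \<comment> \<open>The number of design points in a window of width \<open>q\<close> has order
    \<open>q\<close> to the power -4. In the variance this beats the factor of order
    \<open>1 / q\<^sup>2\<close> coming from \<open>1 / (\<Delta>t)\<^sup>2\<close> and leaves
    \<open>q\<^sup>2\<close>.\<close>
  have q_pow: "real m ^ CARD('d) * q m ^ CARD('d) = 1 / q m ^ 4" if "m \<ge> 1" for m
  proof -
    have "real (n m) * q m powr (4 + D) = 1"
      using q_pos[OF that] by (simp add: n_q[OF that] flip: powr_add)
    then show ?thesis
      using q_pos[OF that] by (simp add: n D_def powr_add powr_realpow field_simps)
  qed
  have q_lim: "q \<longlonglongrightarrow> 0"
  proof (rule Lim_transform_eventually)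
    show "(\<lambda>m. real m powr (- D / (4 + D))) \<longlonglongrightarrow> 0"
      using D by (intro tendsto_neg_powr filterlim_real_sequentially) simp
    show "eventually (\<lambda>m. real m powr (- D / (4 + D)) = q m) sequentially"
      using ev by eventually_elim (simp add: q_eq)
  qed
  \<comment> \<open>The ratio of \<open>q\<close> to the grid spacing \<open>1 / m\<close> is
    \<open>m powr (4 / (4 + D))\<close>, so windows of width \<open>q\<close> eventually span many
    grid cells.\<close>
  have mq_lim: "filterlim (\<lambda>m. real m * q m) at_top sequentially"
  proof (rule filterlim_mono_eventually[OF _ order_refl order_refl])
    show "filterlim (\<lambda>m. real m powr (4 / (4 + D))) at_top sequentially"
      using D by real_asymp
    show "eventually (\<lambda>m. real m powr (4 / (4 + D)) = real m * q m) sequentially"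
      using ev
    proof eventually_elim
      case (elim m)
      have "4 / (4 + D) = 1 + - D / (4 + D)"
        using D by (simp add: field_simps)
      then show ?case
        using elim by (simp only: powr_add q_eq) simp
    qed
  qed
  have q_ev: "eventually (\<lambda>m. q m > 0) sequentially"
    using ev q_pos by (rule eventually_mono)
  have g_ev: "eventually (\<lambda>m. g m > 0) sequentially"
    using ev
  proof eventually_elim
    case (elim m)
    then show ?case
      using dt_pos[of m] n_pos[of m] by (simp add: g_def)
  qed

  \<comment> \<open>Time step and bandwidth are both of order \<open>q\<close>\<close>
  have ev_pos: "eventually (\<lambda>m. \<Delta>t m > 0) sequentially" "eventually (\<lambda>m. h m > 0) sequentially"
    using ev by (eventually_elim, simp add: dt_pos h_pos)+
  obtain c2 where c2: "c2 > 0" "eventually (\<lambda>m. \<Delta>t m \<le> c2 * q m) sequentially"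
    using asymp_le_ennrealD[of \<Delta>t q] q_ev dt by (auto simp: asymp_eq_def q_def D_def)
  obtain c1 where c1: "c1 > 0" "eventually (\<lambda>m. q m \<le> c1 * \<Delta>t m) sequentially"
    using asymp_le_ennrealD[of q \<Delta>t] ev_pos dt by (auto simp: asymp_eq_def q_def D_def)
  obtain e2 where e2: "e2 > 0" "eventually (\<lambda>m. h m \<le> e2 * g m) sequentially"
    using asymp_le_ennrealD[of h g] g_ev h by (auto simp: asymp_eq_def g_def D_def)
  obtain e1 where e1: "e1 > 0" "eventually (\<lambda>m. g m \<le> e1 * h m) sequentially"
    using asymp_le_ennrealD[of g h] ev_pos h by (auto simp: asymp_eq_def g_def D_def)
  \<comment> \<open>The exponent in \<open>g\<close> is negative, so bounds swap: the upper constant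
    \<open>c2\<close> for \<open>\<Delta>t\<close> gives the lower constant for \<open>h\<close>,
    and the lower bound \<open>q m / c1\<close> for \<open>\<Delta>t\<close> gives the upper
    one.\<close>
  define r1 where "r1 = c2 powr (- 2 / (2 + D)) / e1"
  define r2 where "r2 = e2 * (1 / c1) powr (- 2 / (2 + D))"
  have r: "r1 > 0" "r2 > 0"
    using c1 c2 e1 e2 by (auto simp: r1_def r2_def)
  have h_bounds: "eventually (\<lambda>m. r1 * q m \<le> h m \<and> h m \<le> r2 * q m) sequentially"
    using c1(2) c2(2) e1(2) e2(2) ev
  proof eventually_elim
    case (elim m)
    have dt: "\<Delta>t m > 0" and q: "q m > 0" and "real (n m) > 0"
      using elim dt_pos q_pos n_pos by auto
    have "g m \<le> ((1 / c1 * q m)\<^sup>2 * real (n m)) powr (- 1 / (2 + D))"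
      unfolding g_def
    proof (rule powr_mono2')
      show "(1 / c1 * q m)\<^sup>2 * real (n m) \<le> (\<Delta>t m)\<^sup>2 * real (n m)"
        using elim c1 q by (intro mult_right_mono power_mono) (auto simp: field_simps)
    qed (use c1 q D \<open>real (n m) > 0\<close> in auto)
    also have "\<dots> = (1 / c1) powr (- 2 / (2 + D)) * q m"
      unfolding n_q[OF \<open>m \<ge> 1\<close>] using c1 q D by (intro rescaled_powr) auto
    finally have g_le: "g m \<le> (1 / c1) powr (- 2 / (2 + D)) * q m" .
    have "c2 powr (- 2 / (2 + D)) * q m = ((c2 * q m)\<^sup>2 * real (n m)) powr (- 1 / (2 + D))"
      unfolding n_q[OF \<open>m \<ge> 1\<close>] using c2 q D by (intro rescaled_powr[symmetric]) auto
    also have "\<dots> \<le> g m"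
      unfolding g_def
    proof (rule powr_mono2')
      show "(\<Delta>t m)\<^sup>2 * real (n m) \<le> (c2 * q m)\<^sup>2 * real (n m)"
        using elim dt by (intro mult_right_mono power_mono) auto
    qed (use dt D \<open>real (n m) > 0\<close> in auto)
    also have "\<dots> \<le> e1 * h m"
      using elim by simp
    finally have "r1 * q m \<le> h m"
      using e1 by (simp add: r1_def field_simps)
    moreover have "h m \<le> r2 * q m"
      using order_trans[OF \<open>h m \<le> e2 * g m\<close> mult_left_mono[OF g_le]] e2 by (simp add: r2_def mult.assoc)
    ultimately show ?case
      by simp
  qed

  \<comment> \<open>Kernel constants, eventual conditions on the bandwidth, and conclusion\<close>
  obtain a b c C where ab: "0 \<le> a" "a < b" and "c > 0"
    and K: "\<And>z. a \<le> z \<Longrightarrow> z \<le> b \<Longrightarrow> c \<le> K z" "\<And>z. z \<ge> 0 \<Longrightarrow> 0 \<le> K z \<and> K z \<le> C"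
      "\<And>z. z > 1 \<Longrightarrow> K z = 0" and "C > 0"
    using nw_kernel_bounds[OF \<open>nw_kernel K\<close>] by metis
  define l where "l = (b - a) / sqrt CARD('d)"
  have l: "l > 0"
    using ab by (simp add: l_def)
  \<comment> \<open>This and \<open>mh_large\<close> are the two size conditions of the risk bound:
    the annulus must be small enough to reach into the unit cube from any \<open>x0\<close>, yet
    wide compared with the grid spacing.\<close>
  have h_small: "eventually (\<lambda>m. h m * b \<le> 1/2) sequentially"
  proof -
    have "(\<lambda>m. r2 * q m * b) \<longlonglongrightarrow> r2 * 0 * b"
      by (intro tendsto_intros q_lim)
    then have "eventually (\<lambda>m. r2 * q m * b < 1/2) sequentially"
      by (rule order_tendstoD) simp
    then show ?thesis
      using h_bounds
    proof eventually_elim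
      case (elim m)
      then have "h m * b \<le> r2 * q m * b"
        using ab by (intro mult_right_mono) auto
      with elim show ?case
        by linarith
    qed
  qed
  have mh_large: "eventually (\<lambda>m. 2 \<le> real m * (h m * l)) sequentially"
  proof -
    have "eventually (\<lambda>m. 2 / (r1 * l) \<le> real m * q m) sequentially"
      using mq_lim by (simp add: filterlim_at_top)
    then show ?thesis
      using h_bounds
    proof eventually_elim
      case (elim m)
      then have "2 \<le> real m * (r1 * q m * l)"
        using r l by (simp add: field_simps)
      also have "\<dots> \<le> real m * (h m * l)"
        using elim l by (intro mult_left_mono mult_right_mono) auto
      finally show ?case .
    qed
  qed
  \<comment> \<open>The risk bound with \<open>c2 * q m\<close> for \<open>\<Delta>t\<close> and
    \<open>r2 * q m\<close> for \<open>h\<close> in the bias, \<open>q m / c1\<close> and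
    \<open>r1 * q m\<close> in the variance, and \<open>(q m)\<^sup>2\<close> factored out.\<close>
  define R where "R = 2 * (L1 * (L0 * c2 + r2))\<^sup>2 + 2 * (\<sigma>\<^sup>2 * c1\<^sup>2 * (C / (c * (r1 * (l / 2)) ^ CARD('d))))"
  show ?thesis
  proof (rule asymp_le_ennrealI)
    show "R \<ge> 0"
      using \<open>C > 0\<close> \<open>c > 0\<close> r l by (simp add: R_def)
    show "eventually (\<lambda>m. real (n m) powr (- 2 / (4 + real CARD('d))) > 0 \<and>
        (\<integral>\<^sup>+\<omega>. ennreal ((norm (f_hat m \<omega> (x0 m) - f m (x0 m)))\<^sup>2) \<partial>M m)
          \<le> ennreal (R * real (n m) powr (- 2 / (4 + real CARD('d))))) sequentially"
      using c1(2) c2(2) h_bounds h_small mh_large ev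
    proof eventually_elim
      case (elim m)
      interpret prob_space "M m"
        using M elim by simp
      have dt: "\<Delta>t m > 0" and q: "q m > 0" and h: "h m > 0"
        using elim dt_pos q_pos h_pos by auto
      have rate: "real (n m) powr (- 2 / (4 + real CARD('d))) = (q m)\<^sup>2"
        using n_pos[OF \<open>m \<ge> 1\<close>]
        by (simp add: q_def D_def powr_powr flip: powr_numeral)
      let ?s = "c * ((real m * h m) * (l / 2)) ^ CARD('d)"
      have "(\<integral>\<^sup>+\<omega>. ennreal ((norm (\<iota>_hat m \<omega> (x0 m) /\<^sub>R \<Delta>t m - f m (x0 m)))\<^sup>2) \<partial>M m)
          \<le> ennreal (2 * (L1 * (L0 * \<Delta>t m + h m))\<^sup>2 + 2 * (\<sigma>\<^sup>2 / (\<Delta>t m)\<^sup>2 *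
            (C / (c * ((real m * h m) * ((b - a) / (2 * sqrt CARD('d)))) ^ CARD('d)))))"
        by (rule local_constant_risk_bound[OF f[OF \<open>m \<ge> 1\<close>] \<open>L1 > 0\<close> \<open>m \<ge> 1\<close>
              x[OF \<open>m \<ge> 1\<close>, unfolded n] indep[OF \<open>m \<ge> 1\<close>, unfolded n]
              mean[OF \<open>m \<ge> 1\<close>, unfolded n] variance[OF \<open>m \<ge> 1\<close>, unfolded n]
              \<iota>_hat[OF \<open>m \<ge> 1\<close>, unfolded n Y] dt h x0[OF \<open>m \<ge> 1\<close>, rule_format] ab \<open>c > 0\<close> K
              \<open>h m * b \<le> 1/2\<close> \<open>2 \<le> real m * (h m * l)\<close>[unfolded l_def]])
      also have "(b - a) / (2 * sqrt CARD('d)) = l / 2"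
        by (simp add: l_def)
      also have "ennreal (2 * (L1 * (L0 * \<Delta>t m + h m))\<^sup>2 + 2 * (\<sigma>\<^sup>2 / (\<Delta>t m)\<^sup>2 * (C / ?s)))
          \<le> ennreal (R * (q m)\<^sup>2)"
      proof (rule ennreal_leI)
        have "L1 * (L0 * \<Delta>t m + h m) \<le> L1 * (L0 * (c2 * q m) + r2 * q m)"
          using elim \<open>L0 > 0\<close> \<open>L1 > 0\<close> by (intro mult_left_mono add_mono) auto
        then have "(L1 * (L0 * \<Delta>t m + h m))\<^sup>2 \<le> (L1 * (L0 * (c2 * q m) + r2 * q m))\<^sup>2"
          using \<open>L0 > 0\<close> \<open>L1 > 0\<close> dt h by (intro power_mono) auto
        also have "\<dots> = (L1 * (L0 * c2 + r2))\<^sup>2 * (q m)\<^sup>2"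
          by (simp add: algebra_simps flip: power_mult_distrib)
        finally have bias: "(L1 * (L0 * \<Delta>t m + h m))\<^sup>2 \<le> (L1 * (L0 * c2 + r2))\<^sup>2 * (q m)\<^sup>2" .
        have "\<sigma>\<^sup>2 / (\<Delta>t m)\<^sup>2 \<le> \<sigma>\<^sup>2 / (q m / c1)\<^sup>2"
          using elim c1(1) q dt by (intro divide_left_mono power_mono) (auto simp: field_simps)
        moreover have "C / ?s \<le> C / (c * ((real m * (r1 * q m)) * (l / 2)) ^ CARD('d))"
          using elim r l \<open>c > 0\<close> \<open>C > 0\<close> q h
          by (intro divide_left_mono mult_left_mono power_mono mult_right_mono mult_pos_pos zero_less_power) auto
        ultimately have "\<sigma>\<^sup>2 / (\<Delta>t m)\<^sup>2 * (C / ?s)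
            \<le> \<sigma>\<^sup>2 / (q m / c1)\<^sup>2 * (C / (c * ((real m * (r1 * q m)) * (l / 2)) ^ CARD('d)))"
          using \<open>c > 0\<close> \<open>C > 0\<close> h l by (intro mult_mono) auto
        also have "((real m * (r1 * q m)) * (l / 2)) ^ CARD('d)
            = (real m ^ CARD('d) * q m ^ CARD('d)) * (r1 * (l / 2)) ^ CARD('d)"
          by (simp only: power_mult_distrib mult_ac)
        also have "\<dots> = (r1 * (l / 2)) ^ CARD('d) / q m ^ 4"
          by (simp add: q_pow[OF \<open>m \<ge> 1\<close>])
        \<comment> \<open>Here the variance becomes a constant times
          \<open>q m ^ 4 / (q m)\<^sup>2\<close>, of the same order as the squared bias.\<close>
        also have "\<sigma>\<^sup>2 / (q m / c1)\<^sup>2 * (C / (c * ((r1 * (l / 2)) ^ CARD('d) / q m ^ 4)))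
            = \<sigma>\<^sup>2 * c1\<^sup>2 * (C / (c * (r1 * (l / 2)) ^ CARD('d))) * (q m)\<^sup>2"
        proof -
          have "\<sigma>\<^sup>2 / (q m / c1)\<^sup>2 * (C / (c * (z / q m ^ 4))) = \<sigma>\<^sup>2 * c1\<^sup>2 * (C / (c * z)) * (q m)\<^sup>2" for z
            using q by (simp add: power2_eq_square power4_eq_xxxx)
          then show ?thesis .
        qed
        finally show "2 * (L1 * (L0 * \<Delta>t m + h m))\<^sup>2 + 2 * (\<sigma>\<^sup>2 / (\<Delta>t m)\<^sup>2 * (C / ?s)) \<le> R * (q m)\<^sup>2"
          using bias by (simp add: R_def distrib_right)
      qed
      finally show ?case
        using q by (simp only: f_hat rate) simp
    qed
  qed
qed

end
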